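(* Let $\mathbb{K}\in\{\mathbb{R},\mathbb{C}\}$, let $\mathcal{A}$ be a unitary Banach algebra over $\mathbb{K}$, let $\{\alpha_n\}_{n\in\mathbb{N}}\subset\mathbb{K}$ be such that the radius of convergence of $g(\lambda)=\sum_{n=0}^\infty\alpha_n\lambda^n$ is $R>0$, and let $0<r<R$. Let $X$ be a Banach space over $\mathbb{K}$, $D\subseteq X$ an open set, and $\mathcal{T}:D\to\mathcal{A}$ a Fréchet differentiable mapping such that either $\mathcal{T}(D)\subseteq B_r(\mathbf{0})$, or alternatively $D$ is convex and bounded and $\sup_{x\in D}\|\mathcal{T}^{[1]}(x)\|_{B(X,\mathcal{A})}<\infty$. Set $\widetilde{r}=\sup_{x\in D}\|\mathcal{T}(x)\|_{\mathcal{A}}$ and assume $0<\widetilde{r}<\frac{R}{3}$. Then for all $x\in D$ $$[g\circ\mathcal{T}]^{[1]}(x)=\sum_{p=1}^{\infty}\frac{1}{p!}\,g^{(p)}(\mathcal{R}(\mathcal{T}(x)))\,C(\mathcal{T}(x))^{p-1}\,\mathcal{T}^{[1]}(x),$$ and for all $x\in D$, $h\in X$ $$[g\circ\mathcal{T}]^{[1]}(x)(h)=\sum_{p=1}^{\infty}\frac{1}{p!}\,g^{(p)}(\mathcal{T}(x))\,C(\mathcal{T}(x))^{p-1}\bigl(\mathcal{T}^{[1]}(x)(h)\bigr).$$ If in addition $\sup_{x\in D}\|\mathcal{T}^{[1]}(x)\|_{B(X,\mathcal{A})}<\infty$, then the first series is absolutely uniformly convergent on $D$, and the second is absolutely uniformly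 convergent for $(x,h)\in D\times B_L(\mathbf{0})$ for all $L>0$, i.e. $$\sum_{p=1}^{\infty}\frac{1}{p!}\sup_{(x,h)\in D\times B_L(\mathbf{0})}\bigl\|g^{(p)}(\mathcal{T}(x))\,C(\mathcal{T}(x))^{p-1}(\mathcal{T}^{[1]}(x)(h))\bigr\|_{\mathcal{A}}<\infty.$$
   Context: A Banach algebra is an associative algebra over $\mathbb{K}$ with a complete norm satisfying $\|AB\|\le\|A\|\|B\|$; it is unitary if it has a unit $\mathbf{1}$, and then $\|\mathbf{1}\|=1$ is assumed. $\mathbb{N}=\{0,1,2,\dots\}$. $B_r(\mathbf{0})$ is the open ball of radius $r$ about $0$ in the relevant Banach space ($\mathcal{A}$ or $X$). $B(X,\mathcal{A})$ is the Banach space of bounded $\mathbb{K}$-linear maps $X\to\mathcal{A}$ with operator norm and $B(\mathcal{A})=B(\mathcal{A},\mathcal{A})$. For $T\in\mathcal{A}$ define $\mathcal{R}(T),\mathcal{L}(T),C(T)\in B(\mathcal{A})$ by $\mathcal{R}(T)(h)=Th$, $\mathcal{L}(T)(h)=hT$, $C(T)=\mathcal{L}(T)-\mathcal{R}(T)$, i.e. $C(T)(h)=hT-Th$; products and powers of operators are compositions, with zeroth power the identity. For a map $f:U\subseteq F\to G$ between Banach spaces ($U$ open), $f^{[1]}:U\to B(F,G)$ is its Fréchet differential function. If $f(\lambda)=\sum_n\beta_n\lambda^n$ has radius of convergence $R$, then for an element $Q$ of any unitary Banach algebra with $\|Q\|<R$ one sets $f(Q)=\sum_n\beta_nQ^n$;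 this is applied to $g$ and to its $p$-th derivative $g^{(p)}(\lambda)=\sum_{n\ge p}p!\binom{n}{p}\alpha_n\lambda^{n-p}$, both in $\mathcal{A}$ and in $B(\mathcal{A})$. In the second formula $g^{(p)}(\mathcal{T}(x))\in\mathcal{A}$ is multiplied in $\mathcal{A}$ (on the left) with the element $C(\mathcal{T}(x))^{p-1}(\mathcal{T}^{[1]}(x)(h))$. A series $\sum_nf_n$ of maps from a set $S$ to a Banach space $Y$ converges absolutely uniformly on $S$ if $\sum_n\sup_{u\in S}\|f_n(u)\|_Y<\infty$. *)

theory Defs
  imports "HOL-Analysis.Analysis"
begin

(* The distribution has type classes for real Banach spaces and algebras only.  A space over K is
   rendered as a real one (class banach) together with a compatible scalar multiplication by the
   elements of 'k :: real_normed_field.  The norm of such a field is multiplicative, so by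
   Gelfand-Mazur it is isometrically isomorphic to the reals or to the complex numbers. *)

locale normed_space_over = vector_space scale
  for scale :: "'k::real_normed_field \<Rightarrow> 'v::real_normed_vector \<Rightarrow> 'v" +
  assumes norm_scale: "norm (scale c v) = norm c * norm v"
    and scale_of_real: "scale (of_real t) v = t *\<^sub>R v"

(* norm 1 = 1 and submultiplicativity are part of the class real_normed_algebra_1. *)
locale unital_normed_algebra_over = normed_space_over scale
  for scale :: "'k::real_normed_field \<Rightarrow> 'a::real_normed_algebra_1 \<Rightarrow> 'a" +
  assumes scale_mult_left: "scale c x * y = scale c (x * y)"
    and scale_mult_right: "x * scale c y = scale c (x * y)"

lemma normed_space_over_scaleR:
  "normed_space_over (scaleR :: real \<Rightarrow> 'v::real_normed_vector \<Rightarrow> 'v)"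
  by unfold_locales (simp_all add: algebra_simps)

lemma unital_normed_algebra_over_scaleR:
  "unital_normed_algebra_over (scaleR :: real \<Rightarrow> 'a::real_normed_algebra_1 \<Rightarrow> 'a)"
  by unfold_locales (simp_all add: algebra_simps)

lemma unital_normed_algebra_over_mult:
  "unital_normed_algebra_over ((*) :: 'k \<Rightarrow> 'k \<Rightarrow> 'k::real_normed_field)"
  by unfold_locales (simp_all add: algebra_simps norm_mult scaleR_conv_of_real)

(* B(F,G) is the closed subspace of the K-linear elements of the type 'f \<Rightarrow>\<^sub>L 'g of bounded
   real-linear maps; the operator norm is that of the type. *)
definition K_linear ::
    "('k::field \<Rightarrow> 'f \<Rightarrow> 'f) \<Rightarrow> ('k \<Rightarrow> 'g \<Rightarrow> 'g) \<Rightarrow> ('f::real_normed_vector \<Rightarrow>\<^sub>L 'g::real_normed_vector) \<Rightarrow> bool"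
  where "K_linear sF sG L \<longleftrightarrow> Vector_Spaces.linear sF sG (blinfun_apply L)"

definition has_frechet_deriv ::
    "('k::field \<Rightarrow> 'f \<Rightarrow> 'f) \<Rightarrow> ('k \<Rightarrow> 'g \<Rightarrow> 'g) \<Rightarrow>
     ('f::real_normed_vector \<Rightarrow> 'g::real_normed_vector) \<Rightarrow> ('f \<Rightarrow>\<^sub>L 'g) \<Rightarrow> 'f \<Rightarrow> bool"
  where "has_frechet_deriv sF sG f L x \<longleftrightarrow>
    K_linear sF sG L \<and> (f has_derivative blinfun_apply L) (at x)"

definition frechet_differentiable_on ::
    "('k::field \<Rightarrow> 'f \<Rightarrow> 'f) \<Rightarrow> ('k \<Rightarrow> 'g \<Rightarrow> 'g) \<Rightarrow>
     ('f::real_normed_vector \<Rightarrow> 'g::real_normed_vector) \<Rightarrow> 'f set \<Rightarrow> bool"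
  where "frechet_differentiable_on sF sG f U \<longleftrightarrow> (\<forall>x\<in>U. \<exists>L. has_frechet_deriv sF sG f L x)"

definition frechet_deriv ::
    "('k::field \<Rightarrow> 'f \<Rightarrow> 'f) \<Rightarrow> ('k \<Rightarrow> 'g \<Rightarrow> 'g) \<Rightarrow>
     ('f::real_normed_vector \<Rightarrow> 'g::real_normed_vector) \<Rightarrow> 'f \<Rightarrow> ('f \<Rightarrow>\<^sub>L 'g)"
  where "frechet_deriv sF sG f x = (THE L. has_frechet_deriv sF sG f L x)"

lemma frechet_deriv_eq:
  assumes "has_frechet_deriv sF sG f L x"
  shows "frechet_deriv sF sG f x = L"
  unfolding frechet_deriv_def
proof (rule the_equality[where P = "\<lambda>L. has_frechet_deriv sF sG f L x", OF assms])
  fix M assume "has_frechet_deriv sF sG f M x"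
  with assms show "M = L"
    by (auto simp: has_frechet_deriv_def blinfun_apply_inject dest: has_derivative_unique)
qed

(* R(T) h = T h and L(T) h = h T: the letter names the side of T on which h stands. *)
definition R_op :: "'a::real_normed_algebra_1 \<Rightarrow> ('a \<Rightarrow>\<^sub>L 'a)"
  where "R_op T = blinfun_mult_right T"

definition L_op :: "'a::real_normed_algebra_1 \<Rightarrow> ('a \<Rightarrow>\<^sub>L 'a)"
  where "L_op T = blinfun_mult_left T"

definition C_op :: "'a::real_normed_algebra_1 \<Rightarrow> ('a \<Rightarrow>\<^sub>L 'a)"
  where "C_op T = L_op T - R_op T"

lemma C_op_apply: "blinfun_apply (C_op T) h = h * T - T * h"
  unfolding C_op_def L_op_def R_op_def
  by (simp add: blinfun.diff_left)

primrec blinfun_pow :: "('a::real_normed_vector \<Rightarrow>\<^sub>L 'a) \<Rightarrow> nat \<Rightarrow> ('a \<Rightarrow>\<^sub>L 'a)"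
  where
    "blinfun_pow Q 0 = id_blinfun"
  | "blinfun_pow Q (Suc n) = Q o\<^sub>L blinfun_pow Q n"

definition blinfun_scale ::
    "('k::real_normed_field \<Rightarrow> 'g \<Rightarrow> 'g) \<Rightarrow> 'k \<Rightarrow>
     ('f::real_normed_vector \<Rightarrow>\<^sub>L 'g::real_normed_vector) \<Rightarrow> ('f \<Rightarrow>\<^sub>L 'g)"
  where "blinfun_scale s c L = Blinfun (\<lambda>h. s c (blinfun_apply L h))"

lemma (in normed_space_over) blinfun_scale_apply:
  "blinfun_apply (blinfun_scale scale c L) h = scale c (blinfun_apply L h)"
proof -
  have "bounded_linear (scale c)"
  proof (rule bounded_linear_intro[where K = "norm c"])
    show "scale c (r *\<^sub>R x) = r *\<^sub>R scale c x" for r x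
      by (simp flip: scale_of_real add: mult.commute)
  qed (simp_all add: scale_right_distrib norm_scale mult.commute)
  then have "bounded_linear (\<lambda>h. scale c (blinfun_apply L h))"
    using bounded_linear_compose blinfun.bounded_linear_right by blast
  then show ?thesis
    by (simp add: blinfun_scale_def bounded_linear_Blinfun_apply)
qed

(* f(Q) for f = \<Sum>n. \<beta> n * \<lambda>^n: once in the algebra, once in the algebra of operators on it. *)
definition pser_alg :: "('k \<Rightarrow> 'a \<Rightarrow> 'a) \<Rightarrow> (nat \<Rightarrow> 'k) \<Rightarrow> 'a::real_normed_algebra_1 \<Rightarrow> 'a"
  where "pser_alg s \<beta> Q = (\<Sum>n. s (\<beta> n) (Q ^ n))"

definition pser_op ::
    "('k::real_normed_field \<Rightarrow> 'a \<Rightarrow> 'a) \<Rightarrow> (nat \<Rightarrow> 'k) \<Rightarrow>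
     ('a::real_normed_vector \<Rightarrow>\<^sub>L 'a) \<Rightarrow> ('a \<Rightarrow>\<^sub>L 'a)"
  where "pser_op s \<beta> Q = (\<Sum>n. blinfun_scale s (\<beta> n) (blinfun_pow Q n))"

(* Coefficients of the p-th derivative, with n - p shifted to n. *)
definition deriv_coeffs :: "nat \<Rightarrow> (nat \<Rightarrow> 'k::real_normed_field) \<Rightarrow> nat \<Rightarrow> 'k"
  where "deriv_coeffs p \<alpha> n = fact p * of_nat ((n + p) choose p) * \<alpha> (n + p)"

definition series1_term ::
    "('k::real_normed_field \<Rightarrow> 'x \<Rightarrow> 'x) \<Rightarrow> ('k \<Rightarrow> 'a \<Rightarrow> 'a) \<Rightarrow> (nat \<Rightarrow> 'k) \<Rightarrow>
     ('x::real_normed_vector \<Rightarrow> 'a::real_normed_algebra_1) \<Rightarrow> nat \<Rightarrow> 'x \<Rightarrow> ('x \<Rightarrow>\<^sub>L 'a)"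
  where "series1_term sX sA \<alpha> T p x =
    (1 / fact p) *\<^sub>R
      (pser_op sA (deriv_coeffs p \<alpha>) (R_op (T x)) o\<^sub>L blinfun_pow (C_op (T x)) (p - 1)
        o\<^sub>L frechet_deriv sX sA T x)"

(* The summand of the second series without the factor 1 / p!. *)
definition series2_term ::
    "('k::real_normed_field \<Rightarrow> 'x \<Rightarrow> 'x) \<Rightarrow> ('k \<Rightarrow> 'a \<Rightarrow> 'a) \<Rightarrow> (nat \<Rightarrow> 'k) \<Rightarrow>
     ('x::real_normed_vector \<Rightarrow> 'a::real_normed_algebra_1) \<Rightarrow> nat \<Rightarrow> 'x \<Rightarrow> 'x \<Rightarrow> 'a"
  where "series2_term sX sA \<alpha> T p x h =
    pser_alg sA (deriv_coeffs p \<alpha>) (T x) *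
      blinfun_apply (blinfun_pow (C_op (T x)) (p - 1)) (blinfun_apply (frechet_deriv sX sA T x) h)"

definition abs_uniformly_convergent_on ::
    "'s set \<Rightarrow> (nat \<Rightarrow> 's \<Rightarrow> 'y::real_normed_vector) \<Rightarrow> bool"
  where "abs_uniformly_convergent_on S f \<longleftrightarrow> (\<Sum>n. SUP u\<in>S. ennreal (norm (f n u))) < \<infinity>"

end

theory Submission
  imports Defs
begin

text \<open>
  Left multiplication \<open>R\<close> by \<open>Q\<close> and right multiplication \<open>L\<close> by \<open>Q\<close> commute, and \<open>L = R + C\<close>
  for the commutator \<open>C\<close> with \<open>Q\<close>.  The Frechet derivative of \<open>Q \<mapsto> Q ^ n\<close> is the divided
  difference \<open>(L ^ n - R ^ n) / (L - R)\<close>, which the binomial theorem for \<open>(R + C) ^ n\<close> expands as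
  \<open>\<Sum>p=1..n. (n choose p) R ^ (n - p) C ^ (p - 1)\<close> (lemma \<open>has_derivative_power_commutator\<close>).
  Multiplied by \<open>\<alpha> n\<close> and summed over \<open>n\<close>, this is the derivative of \<open>g\<close>
  (\<open>pser_alg_has_derivative\<close>); collecting instead all terms with the same \<open>p\<close> gives
  \<open>g\<^sup>(\<^sup>p\<^sup>)(R) C ^ (p - 1) / p!\<close> (\<open>pser_op_compose_eq_row\<close>).  The chain rule then
  supplies the derivative of \<open>T\<close> as the last factor.

  The exchange of the two summations (\<open>diagonal_double_series\<close>) is where a third of the radius
  of convergence enters.  Fix \<open>\<rho>\<close> strictly between \<open>sup \<parallel>T x\<parallel>\<close> and that third,
  and let \<open>Q = T x\<close>.  Then \<open>\<parallel>R\<parallel> \<le> \<rho>\<close> and \<open>\<parallel>C\<parallel> \<le> 2 \<rho>\<close>, so the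
  norms of the terms belonging to \<open>Q ^ n\<close> add up to at most
  \<open>\<bar>\<alpha> n\<bar> (\<rho> + 2 \<rho>) ^ n / (2 \<rho>)\<close>, and \<open>\<Sum>n. \<bar>\<alpha> n\<bar> (3 \<rho>) ^ n\<close> converges
  (\<open>summable_weight\<close>).  The majorant depends on \<open>\<rho>\<close> only, not on \<open>x\<close>, and therefore
  also yields the uniform convergence on \<open>D\<close> once the derivative of \<open>T\<close> is bounded.
\<close>

section \<open>Rearranging dominated double series\<close>

text \<open>Domination makes the family summable over all pairs, so that summing along the rows and
  summing along the antidiagonals \<open>p + m = n\<close> are two ways of computing one unordered sum.\<close>
lemma diagonal_double_series:
  fixes f :: "nat \<Rightarrow> nat \<Rightarrow> 'b::banach"
  assumes bound: "\<And>p m. norm (f p m) \<le> w p m"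
    and w: "summable (\<lambda>n. \<Sum>p\<le>n. w p (n - p))"
  shows "summable (f p)"
    and "summable (\<lambda>n. \<Sum>p\<le>n. f p (n - p))"
    and "(\<lambda>p. \<Sum>m. f p m) sums (\<Sum>n. \<Sum>p\<le>n. f p (n - p))"
proof -
  define F where "F = (\<lambda>(p, m). f p m)"
  define d where "d = (\<lambda>(n::nat, p::nat). (p, n - p))"
  have d: "bij_betw d (Sigma UNIV atMost) (UNIV \<times> UNIV)"
    by (rule bij_betw_byWitness[where f' = "\<lambda>(p, m). (p + m, p)"]) (auto simp: d_def)
  have w_nonneg: "0 \<le> w p m" for p m
    using bound[of p m] norm_ge_zero order_trans by blast
  have diag: "norm (\<Sum>p\<le>n. norm (f p (n - p))) \<le> (\<Sum>p\<le>n. w p (n - p))" for n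
    by (simp add: sum_nonneg) (intro sum_mono bound)
  have sum_diag: "summable (\<lambda>n. \<Sum>p\<le>n. norm (f p (n - p)))"
    using summable_comparison_test'[OF w diag] by blast
  have "(\<lambda>x. norm (F (d x))) summable_on Sigma UNIV atMost"
  proof (rule iffD2[OF Infinite_Sum.abs_summable_on_Sigma_iff], intro conjI ballI)
    show "(\<lambda>n. norm (\<Sum>\<^sub>\<infinity>p\<in>{..n}. norm (F (d (n, p))))) summable_on UNIV"
      using sum_diag by (auto simp: F_def d_def sum_nonneg intro!: summable_nonneg_imp_summable_on)
  qed simp
  then have normF: "(\<lambda>x. norm (F x)) summable_on UNIV \<times> UNIV"
    using summable_on_reindex_bij_betw[OF d, of "\<lambda>x. norm (F x)"] by simp
  then have "F summable_on UNIV \<times> UNIV"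
    by (rule abs_summable_summable)
  then have F: "(F has_sum infsum F (UNIV \<times> UNIV)) (UNIV \<times> UNIV)"
    by (rule has_sum_infsum)
  have row: "(\<lambda>m. norm (f p m)) summable_on UNIV" for p
    using normF unfolding Infinite_Sum.abs_summable_on_Sigma_iff by (simp add: F_def)
  have row_sum: "(f p has_sum (\<Sum>m. f p m)) UNIV" for p
  proof -
    have "summable (\<lambda>m. norm (f p m))"
      using row summable_on_imp_summable by blast
    then show ?thesis
      using norm_summable_imp_has_sum summable_norm_cancel summable_sums by blast
  qed
  show "summable (f p)"
    using row_sum has_sum_imp_sums sums_summable by blast
  have rows: "((\<lambda>p. \<Sum>m. f p m) has_sum infsum F (UNIV \<times> UNIV)) UNIV"
    using has_sum_SigmaD[OF F, of "\<lambda>p. \<Sum>m. f p m"] row_sum by (simp add: F_def)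
  have "((\<lambda>x. F (d x)) has_sum infsum F (UNIV \<times> UNIV)) (Sigma UNIV atMost)"
    using F has_sum_reindex_bij_betw[OF d] by blast
  then have diags: "((\<lambda>n. \<Sum>p\<le>n. f p (n - p)) has_sum infsum F (UNIV \<times> UNIV)) UNIV"
    by (rule has_sum_SigmaD) (auto simp: F_def d_def intro!: has_sum_finiteI)
  show "summable (\<lambda>n. \<Sum>p\<le>n. f p (n - p))"
    using diags has_sum_imp_sums sums_summable by blast
  show "(\<lambda>p. \<Sum>m. f p m) sums (\<Sum>n. \<Sum>p\<le>n. f p (n - p))"
    using diags rows has_sum_imp_sums sums_unique by metis
qed

lemma ennreal_suminf_le_finite:
  assumes "\<And>n. f n \<le> ennreal (a n)" "summable a" "\<And>n. 0 \<le> a n"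
  shows "(\<Sum>n. f n) < \<infinity>"
proof -
  have "(\<Sum>n. f n) \<le> (\<Sum>n. ennreal (a n))"
    by (rule suminf_le) (auto intro: assms)
  also have "\<dots> = ennreal (\<Sum>n. a n)"
    using assms by (simp add: suminf_ennreal2)
  finally show ?thesis
    by (rule le_less_trans) simp
qed

section \<open>Powers and commutators\<close>

text \<open>This is the binomial theorem for \<open>L ^ n = (R + C) ^ n\<close>.  The operators commute, but they live
  in a noncommutative algebra of operators, so Pascal's rule is applied by hand: pulling
  one more factor \<open>Q\<close> from the right of \<open>C ^ p h\<close> to its left costs a term \<open>C ^ (p + 1) h\<close>.\<close>
lemma right_mult_power_commutator:
  fixes Q h :: "'a::real_normed_algebra_1"
  shows "h * Q ^ n = (\<Sum>p\<le>n. real (n choose p) *\<^sub>R (Q ^ (n - p) * blinfun_pow (C_op Q) p h))"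
proof (induction n)
  case (Suc n)
  let ?c = "\<lambda>p. blinfun_pow (C_op Q) p h"
  have swap: "?c p * Q = Q * ?c p + ?c (Suc p)" for p
    by (simp add: C_op_apply)
  have "h * Q ^ Suc n = (h * Q ^ n) * Q"
    by (simp add: power_Suc2 mult.assoc del: power_Suc)
  also have "\<dots> = (\<Sum>p\<le>n. real (n choose p) *\<^sub>R (Q ^ (n - p) * (?c p * Q)))"
    by (simp add: Suc.IH sum_distrib_right mult.assoc)
  also have "\<dots> = (\<Sum>p\<le>n. real (n choose p) *\<^sub>R (Q ^ (Suc n - p) * ?c p))
               + (\<Sum>p\<le>n. real (n choose p) *\<^sub>R (Q ^ (Suc n - Suc p) * ?c (Suc p)))"
    unfolding swap
    by (simp add: distrib_left scaleR_add_right sum.distrib Suc_diff_le power_Suc2 mult.assoc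
        del: power_Suc blinfun_pow.simps)
  also have "(\<Sum>p\<le>n. real (n choose p) *\<^sub>R (Q ^ (Suc n - p) * ?c p))
      = (\<Sum>p\<le>Suc n. real (n choose p) *\<^sub>R (Q ^ (Suc n - p) * ?c p))"
    by simp
  also have "\<dots> = Q ^ Suc n * h + (\<Sum>p\<le>n. real (n choose Suc p) *\<^sub>R (Q ^ (Suc n - Suc p) * ?c (Suc p)))"
    by (subst sum.atMost_Suc_shift) simp
  finally show ?case
    by (subst sum.atMost_Suc_shift)
       (simp add: sum.distrib scaleR_add_left del: blinfun_pow.simps(2) power_Suc)
qed simp

text \<open>The divided difference of \<open>\<lambda>^(n+1)\<close> at \<open>R\<close> and \<open>R + C\<close>.  The product rule turns \<open>Q * Q ^ (n + 1)\<close>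
  into \<open>Q\<close> times the derivative of \<open>Q ^ (n + 1)\<close> plus \<open>h * Q ^ (n + 1)\<close>; with the latter
  expanded by the preceding lemma the coefficients combine by Pascal's rule.\<close>
lemma has_derivative_power_commutator:
  fixes Q :: "'a::real_normed_algebra_1"
  shows "((\<lambda>Q. Q ^ Suc n) has_derivative
    (\<lambda>h. \<Sum>p\<le>n. real (Suc n choose Suc p) *\<^sub>R (Q ^ (n - p) * blinfun_pow (C_op Q) p h))) (at Q within S)"
proof (induction n)
  case (Suc n)
  let ?c = "\<lambda>p h. blinfun_pow (C_op Q) p h"
  have "Q * (\<Sum>p\<le>n. real (Suc n choose Suc p) *\<^sub>R (Q ^ (n - p) * ?c p h)) + h * Q ^ Suc n
      = (\<Sum>p\<le>Suc n. real (Suc (Suc n) choose Suc p) *\<^sub>R (Q ^ (Suc n - p) * ?c p h))" for h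
  proof -
    have "Q * (\<Sum>p\<le>n. real (Suc n choose Suc p) *\<^sub>R (Q ^ (n - p) * ?c p h))
        = (\<Sum>p\<le>n. real (Suc n choose Suc p) *\<^sub>R (Q ^ (Suc n - p) * ?c p h))"
      by (simp add: sum_distrib_left Suc_diff_le mult.assoc)
    also have "\<dots> = (\<Sum>p\<le>Suc n. real (Suc n choose Suc p) *\<^sub>R (Q ^ (Suc n - p) * ?c p h))"
      by (simp add: binomial_eq_0 del: binomial_Suc_Suc)
    finally show ?thesis
      unfolding right_mult_power_commutator[of h Q "Suc n"]
      by (simp only: sum.distrib[symmetric] binomial_Suc_Suc[of "Suc n"] of_nat_add scaleR_add_left
          add.commute)
  qed
  with has_derivative_mult[OF has_derivative_ident Suc.IH] show ?case
    by (simp add: power_Suc[of _ "Suc n"] del: power_Suc)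
qed simp

lemma blinfun_pow_R_op: "blinfun_pow (R_op Q) n h = Q ^ n * h"
  by (induction n arbitrary: h) (simp_all add: R_op_def mult.assoc)

lemma norm_blinfun_pow: "norm (blinfun_pow Q n) \<le> norm Q ^ n"
proof (induction n)
  case 0
  then show ?case using norm_blinfun_id_le by simp
next
  case (Suc n)
  have "norm (Q o\<^sub>L blinfun_pow Q n) \<le> norm Q * norm (blinfun_pow Q n)"
    by (rule norm_blinfun_compose)
  with Suc show ?case
    by (simp add: mult_left_mono order_trans)
qed

lemma norm_R_op: "norm (R_op Q) \<le> norm Q"
  unfolding R_op_def by (rule norm_blinfun_bound) (auto simp: norm_mult_ineq)

lemma norm_C_op: "norm (C_op Q) \<le> 2 * norm Q"
proof -
  have "norm (L_op Q) \<le> norm Q"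
    unfolding L_op_def by (rule norm_blinfun_bound) (auto simp: norm_mult_ineq mult.commute[of "norm Q"])
  then show ?thesis
    using norm_R_op[of Q] norm_triangle_ineq4[of "L_op Q" "R_op Q"] by (simp add: C_op_def)
qed


section \<open>The double series behind the two expansions\<close>

lemma (in normed_space_over) norm_blinfun_scale:
  "norm (blinfun_scale scale c L) \<le> norm c * norm L"
  by (rule norm_blinfun_bound)
     (simp_all add: blinfun_scale_apply norm_scale mult.assoc mult_left_mono norm_blinfun)

lemma (in normed_space_over) bounded_linear_scale: "bounded_linear (scale c)"
proof -
  have "blinfun_apply (blinfun_scale scale c id_blinfun) = scale c"
    by (simp add: blinfun_scale_apply fun_eq_iff)
  then show ?thesis
    using blinfun.bounded_linear_right by metis
qed

text \<open>The summability condition holds whenever \<open>3 \<rho>\<close> is less than the radius of convergence of \<open>\<alpha>\<close>.\<close>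
locale banach_algebra_power_series = unital_normed_algebra_over sA
  for sA :: "'k::real_normed_field \<Rightarrow> 'a::{real_normed_algebra_1,banach} \<Rightarrow> 'a" +
  fixes \<alpha> :: "nat \<Rightarrow> 'k" and \<rho> :: real
  assumes rho_pos: "0 < \<rho>"
    and summable_alpha: "summable (\<lambda>n. norm (\<alpha> n) * (3 * \<rho>) ^ n)"
begin

text \<open>The contribution of \<open>\<alpha> n Q ^ n\<close> with \<open>n = m + p + 1\<close> to the derivative.  Both indices are
  shifted so that they range over all natural numbers; \<open>p\<close> here is \<open>p - 1\<close> in the informal
  expansion, and the antidiagonal \<open>p + m = n\<close> collects the derivative of \<open>\<alpha> (n + 1) Q ^ (n + 1)\<close>.\<close>
definition RC_term :: "'a \<Rightarrow> nat \<Rightarrow> nat \<Rightarrow> ('a \<Rightarrow>\<^sub>L 'a)"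
  where "RC_term Q p m = blinfun_scale sA (of_nat (m + Suc p choose Suc p) * \<alpha> (m + Suc p))
    (blinfun_pow (R_op Q) m o\<^sub>L blinfun_pow (C_op Q) p)"

definition weight :: "nat \<Rightarrow> nat \<Rightarrow> real"
  where "weight p m = norm (\<alpha> (m + Suc p)) * real (m + Suc p choose Suc p) * \<rho> ^ m * (2 * \<rho>) ^ p"

definition pser_deriv :: "'a \<Rightarrow> ('a \<Rightarrow>\<^sub>L 'a)"
  where "pser_deriv Q = (\<Sum>n. \<Sum>p\<le>n. RC_term Q p (n - p))"

text \<open>Up to the factor \<open>\<bar>\<alpha> (n + 1)\<bar>\<close>, the sum over the \<open>n\<close>th antidiagonal is the binomial expansion
  of \<open>(2 \<rho> + \<rho>) ^ (n + 1)\<close> without its term \<open>\<rho> ^ (n + 1)\<close>, divided by \<open>2 \<rho>\<close>.\<close>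
lemma summable_weight: "summable (\<lambda>n. \<Sum>p\<le>n. weight p (n - p))"
proof (rule summable_comparison_test')
  show "summable (\<lambda>n. norm (\<alpha> (Suc n)) * (3 * \<rho>) ^ Suc n / (2 * \<rho>))"
    using summable_alpha by (intro summable_divide) (rule summable_Suc_iff[THEN iffD2])
  fix n
  let ?S = "\<Sum>p\<le>n. real (Suc n choose Suc p) * (2 * \<rho>) ^ p * \<rho> ^ (n - p)"
  have "(3 * \<rho>) ^ Suc n = (2 * \<rho> + \<rho>) ^ Suc n"
    by simp
  also have "\<dots> = (\<Sum>q\<le>Suc n. real (Suc n choose q) * (2 * \<rho>) ^ q * \<rho> ^ (Suc n - q))"
    by (rule binomial_ring)
  also have "\<dots> = \<rho> ^ Suc n + 2 * \<rho> * ?S"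
    by (subst sum.atMost_Suc_shift)
       (simp add: sum_distrib_left mult_ac del: binomial_Suc_Suc)
  finally have S: "?S \<le> (3 * \<rho>) ^ Suc n / (2 * \<rho>)"
    using rho_pos by (simp add: field_simps del: power_Suc)
  have "(\<Sum>p\<le>n. weight p (n - p)) = norm (\<alpha> (Suc n)) * ?S"
    unfolding sum_distrib_left weight_def
    by (rule sum.cong) (simp_all add: mult_ac del: binomial_Suc_Suc)
  moreover have "0 \<le> (\<Sum>p\<le>n. weight p (n - p))"
    using rho_pos by (intro sum_nonneg) (simp add: weight_def)
  ultimately show "norm (\<Sum>p\<le>n. weight p (n - p)) \<le> norm (\<alpha> (Suc n)) * (3 * \<rho>) ^ Suc n / (2 * \<rho>)"
    using mult_left_mono[OF S, of "norm (\<alpha> (Suc n))"]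
    by (simp only: real_norm_def abs_of_nonneg times_divide_eq_right norm_ge_zero)
qed

lemma weight_nonneg: "0 \<le> weight p m"
  using rho_pos by (simp add: weight_def)

lemma summable_weight_row: "summable (weight p)"
  and summable_weight_rows: "summable (\<lambda>p. \<Sum>m. weight p m)"
  using diagonal_double_series[OF _ summable_weight, of weight] weight_nonneg
  by (auto intro: sums_summable)

context
  fixes Q :: 'a
  assumes Q: "norm Q < \<rho>"
begin

lemma norm_pow_R_op: "norm (blinfun_pow (R_op Q) m) \<le> \<rho> ^ m"
  and norm_pow_C_op: "norm (blinfun_pow (C_op Q) p) \<le> (2 * \<rho>) ^ p"
proof -
  have "norm (R_op Q) \<le> \<rho>" "norm (C_op Q) \<le> 2 * \<rho>"
    using norm_R_op[of Q] norm_C_op[of Q] Q by auto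
  then show "norm (blinfun_pow (R_op Q) m) \<le> \<rho> ^ m" "norm (blinfun_pow (C_op Q) p) \<le> (2 * \<rho>) ^ p"
    using norm_blinfun_pow order_trans power_mono norm_ge_zero by meson+
qed

lemma norm_RC_term: "norm (RC_term Q p m) \<le> weight p m"
proof -
  have "norm (blinfun_pow (R_op Q) m o\<^sub>L blinfun_pow (C_op Q) p) \<le> \<rho> ^ m * (2 * \<rho>) ^ p"
    using rho_pos norm_blinfun_compose order_trans
    by (smt (verit, best) mult_mono norm_ge_zero norm_pow_C_op norm_pow_R_op zero_le_power)
  then show ?thesis
    unfolding RC_term_def weight_def
    by (intro order_trans[OF norm_blinfun_scale])
       (simp add: norm_mult mult.assoc mult_left_mono del: binomial_Suc_Suc)
qed

lemma summable_diag: "summable (\<lambda>n. \<Sum>p\<le>n. RC_term Q p (n - p))"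
  and rows_sums_pser_deriv: "(\<lambda>p. \<Sum>m. RC_term Q p m) sums pser_deriv Q"
  unfolding pser_deriv_def
  by (rule diagonal_double_series[OF norm_RC_term summable_weight])+

lemma norm_row_le: "norm (\<Sum>m. RC_term Q p m) \<le> (\<Sum>m. weight p m)"
  by (rule norm_suminf_le[OF norm_RC_term summable_weight_row])

end

lemma diag_apply:
  "blinfun_apply (\<Sum>p\<le>n. RC_term Q p (n - p)) h =
    sA (\<alpha> (Suc n)) (\<Sum>p\<le>n. real (Suc n choose Suc p) *\<^sub>R (Q ^ (n - p) * blinfun_pow (C_op Q) p h))"
proof -
  have "sA (of_nat b * a) v = sA a (real b *\<^sub>R v)" for a b v
    by (simp add: mult.commute[of "of_nat b"] scale_of_real[symmetric] flip: scale_scale)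
  then show ?thesis
    by (simp add: blinfun.sum_left RC_term_def blinfun_scale_apply blinfun_pow_R_op scale_sum_right
        del: binomial_Suc_Suc)
qed

lemma summable_pser_alg:
  assumes "norm Q < \<rho>"
  shows "summable (\<lambda>n. sA (\<alpha> n) (Q ^ n))"
proof (rule summable_comparison_test'[OF summable_alpha])
  fix n
  have "norm (Q ^ n) \<le> (3 * \<rho>) ^ n"
    using norm_power_ineq[of Q n] power_mono[of "norm Q" "3 * \<rho>" n] assms rho_pos by force
  then show "norm (sA (\<alpha> n) (Q ^ n)) \<le> norm (\<alpha> n) * (3 * \<rho>) ^ n"
    by (simp add: norm_scale mult_left_mono)
qed

text \<open>The differentiated series converges uniformly on the ball of radius \<open>\<rho>\<close> in operator norm,
  by the Weierstrass test with the antidiagonal sums of the weights, so termwise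
  differentiation is allowed.  The constant term is treated apart: the derivative of
  \<open>Q ^ n\<close> has the shape of an antidiagonal only for \<open>n \<ge> 1\<close>.\<close>
lemma pser_alg_has_derivative:
  assumes Q: "norm Q < \<rho>"
  shows "(pser_alg sA \<alpha> has_derivative blinfun_apply (pser_deriv Q)) (at Q)"
proof -
  let ?B = "ball 0 \<rho> :: 'a set"
  let ?A = "\<lambda>Q n. \<Sum>p\<le>n. RC_term Q p (n - p)"
  have unif: "uniform_limit ?B (\<lambda>n Q. \<Sum>i<n. ?A Q i) pser_deriv sequentially"
    unfolding pser_deriv_def
  proof (rule Weierstrass_m_test[OF _ summable_weight])
    show "norm (?A Q n) \<le> (\<Sum>p\<le>n. weight p (n - p))" if "Q \<in> ?B" for Q n
      using that by (intro sum_norm_le norm_RC_term) simp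
  qed
  have shifted: "\<exists>g. \<forall>Q\<in>?B. (\<lambda>n. sA (\<alpha> (Suc n)) (Q ^ Suc n)) sums g Q
      \<and> (g has_derivative blinfun_apply (pser_deriv Q)) (at Q within ?B)"
  proof (rule has_derivative_series)
    show "((\<lambda>Q. sA (\<alpha> (Suc n)) (Q ^ Suc n)) has_derivative blinfun_apply (?A Q n)) (at Q within ?B)" for n Q
      using bounded_linear.has_derivative[OF bounded_linear_scale has_derivative_power_commutator]
      by (rule has_derivative_eq_rhs) (simp add: diag_apply fun_eq_iff)
    show "\<forall>\<^sub>F n in sequentially. \<forall>Q\<in>?B. \<forall>h.
        norm ((\<Sum>i<n. blinfun_apply (?A Q i) h) - blinfun_apply (pser_deriv Q) h) \<le> e * norm h"
      if "e > 0" for e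
      using uniform_limitD[OF unif that]
    proof eventually_elim
      case (elim n)
      have "norm ((\<Sum>i<n. blinfun_apply (?A Q i) h) - blinfun_apply (pser_deriv Q) h) \<le> e * norm h"
        if "Q \<in> ?B" for Q h
      proof -
        have "norm (blinfun_apply ((\<Sum>i<n. ?A Q i) - pser_deriv Q) h)
            \<le> norm ((\<Sum>i<n. ?A Q i) - pser_deriv Q) * norm h"
          by (rule norm_blinfun)
        also have "\<dots> \<le> e * norm h"
          using elim that by (intro mult_right_mono) (auto simp: dist_norm less_imp_le)
        finally show ?thesis
          by (simp add: blinfun.diff_left blinfun.sum_left)
      qed
      then show ?case by blast
    qed
    show "(\<lambda>n. sA (\<alpha> (Suc n)) (0 ^ Suc n)) sums 0"
      by simp
  qed (use rho_pos in auto)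
  then obtain g where g: "\<And>Q. Q \<in> ?B \<Longrightarrow> (\<lambda>n. sA (\<alpha> (Suc n)) (Q ^ Suc n)) sums g Q"
    and dg: "\<And>Q. Q \<in> ?B \<Longrightarrow> (g has_derivative blinfun_apply (pser_deriv Q)) (at Q within ?B)"
    by blast
  have eq: "sA (\<alpha> 0) 1 + g P = pser_alg sA \<alpha> P" if "P \<in> ?B" for P
    unfolding pser_alg_def
    using suminf_split_head[OF summable_pser_alg, of P] sums_unique[OF g[OF that]] that by simp
  have "(g has_derivative blinfun_apply (pser_deriv Q)) (at Q)"
    using dg[of Q] Q by (simp add: at_within_open[of Q ?B])
  from has_derivative_add[OF has_derivative_const this]
  have "((\<lambda>P. sA (\<alpha> 0) 1 + g P) has_derivative blinfun_apply (pser_deriv Q)) (at Q)"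
    by (simp add: eta_contract_eq)
  then show ?thesis
    by (rule has_derivative_transform_within_open[where s = ?B]) (use Q eq in auto)
qed

text \<open>Real linearity is built into the type; compatibility with scalars in \<open>'k\<close> holds for
  every term, since multiplication in the algebra is bilinear over \<open>'k\<close>, and passes to the limit.\<close>
lemma K_linear_pser_deriv:
  assumes Q: "norm Q < \<rho>"
  shows "K_linear sA sA (pser_deriv Q)"
proof -
  have C: "blinfun_pow (C_op Q) p (sA c h) = sA c (blinfun_pow (C_op Q) p h)" for p c h
    by (induction p arbitrary: h)
       (simp_all add: C_op_apply scale_mult_left scale_mult_right scale_right_diff_distrib)
  have "blinfun_apply (pser_deriv Q) (sA c h) = sA c (blinfun_apply (pser_deriv Q) h)" for c h
  proof -
    let ?A = "\<lambda>n. \<Sum>p\<le>n. RC_term Q p (n - p)"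
    have A: "(\<lambda>n. blinfun_apply (?A n) h) sums blinfun_apply (pser_deriv Q) h" for h
      unfolding pser_deriv_def
      by (rule bounded_linear.sums[OF blinfun.bounded_linear_left summable_sums[OF summable_diag[OF Q]]])
    have "blinfun_apply (?A n) (sA c h) = sA c (blinfun_apply (?A n) h)" for n
      by (simp add: blinfun.sum_left RC_term_def blinfun_scale_apply blinfun_pow_R_op C
          scale_mult_right scale_sum_right mult_ac)
    with A[of "sA c h"] bounded_linear.sums[OF bounded_linear_scale[of c] A[of h]]
    show ?thesis
      using sums_unique2 by auto
  qed
  then show ?thesis
    unfolding K_linear_def by (simp add: Vector_Spaces.linear_iff vector_space_axioms blinfun.add_right)
qed

text \<open>The operator series without the factor \<open>C ^ p\<close> is a row of the double series with the factor
  \<open>(2 \<rho>) ^ p\<close> of the weight divided out, so it needs no estimate of its own.\<close>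
lemma summable_pser_op:
  assumes Q: "norm Q < \<rho>"
  shows "summable (\<lambda>m. blinfun_scale sA (deriv_coeffs (Suc p) \<alpha> m) (blinfun_pow (R_op Q) m))"
proof (rule summable_comparison_test')
  show "summable (\<lambda>m. fact (Suc p) / (2 * \<rho>) ^ p * weight p m)"
    by (rule summable_mult[OF summable_weight_row])
  fix m
  have "norm (blinfun_scale sA (deriv_coeffs (Suc p) \<alpha> m) (blinfun_pow (R_op Q) m))
      \<le> norm (deriv_coeffs (Suc p) \<alpha> m) * \<rho> ^ m"
    using order_trans[OF norm_blinfun_scale mult_left_mono[OF norm_pow_R_op[OF Q] norm_ge_zero]] .
  also have "\<dots> = fact (Suc p) / (2 * \<rho>) ^ p * weight p m"
    using rho_pos
    by (simp add: deriv_coeffs_def weight_def norm_mult norm_fact field_simps del: fact_Suc binomial_Suc_Suc)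
  finally show "norm (blinfun_scale sA (deriv_coeffs (Suc p) \<alpha> m) (blinfun_pow (R_op Q) m))
      \<le> fact (Suc p) / (2 * \<rho>) ^ p * weight p m" .
qed

text \<open>The factor \<open>(p + 1)!\<close> in the coefficients of the derivative of that order cancels
  and leaves the binomial coefficients of the double series.\<close>
lemma pser_op_compose_eq_row:
  assumes Q: "norm Q < \<rho>"
  shows "(1 / fact (Suc p)) *\<^sub>R
      (pser_op sA (deriv_coeffs (Suc p) \<alpha>) (R_op Q) o\<^sub>L blinfun_pow (C_op Q) p) = (\<Sum>m. RC_term Q p m)"
proof (rule sums_unique)
  have "(\<lambda>m. (1 / fact (Suc p)) *\<^sub>R (blinfun_scale sA (deriv_coeffs (Suc p) \<alpha> m) (blinfun_pow (R_op Q) m)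
        o\<^sub>L blinfun_pow (C_op Q) p))
    sums ((1 / fact (Suc p)) *\<^sub>R
      (pser_op sA (deriv_coeffs (Suc p) \<alpha>) (R_op Q) o\<^sub>L blinfun_pow (C_op Q) p))"
    unfolding pser_op_def
    by (intro sums_scaleR_right summable_sums[OF summable_pser_op[OF Q]]
        bounded_linear.sums[OF bounded_bilinear.bounded_linear_left[OF bounded_bilinear_blinfun_compose]])
  moreover have "(1 / fact (Suc p)) *\<^sub>R (blinfun_scale sA (deriv_coeffs (Suc p) \<alpha> m) (blinfun_pow (R_op Q) m)
        o\<^sub>L blinfun_pow (C_op Q) p) = RC_term Q p m" for m
  proof (rule blinfun_eqI)
    fix h
    let ?v = "Q ^ m * blinfun_pow (C_op Q) p h"
    have "(1 / fact (Suc p)) *\<^sub>R sA (deriv_coeffs (Suc p) \<alpha> m) ?v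
        = sA (of_real (1 / fact (Suc p)) * deriv_coeffs (Suc p) \<alpha> m) ?v"
      by (simp only: scale_of_real[symmetric] scale_scale)
    also have "of_real (1 / fact (Suc p)) * deriv_coeffs (Suc p) \<alpha> m
        = of_nat (m + Suc p choose Suc p) * \<alpha> (m + Suc p)"
      by (simp add: deriv_coeffs_def of_real_divide del: fact_Suc binomial_Suc_Suc)
    finally show "blinfun_apply ((1 / fact (Suc p)) *\<^sub>R
          (blinfun_scale sA (deriv_coeffs (Suc p) \<alpha> m) (blinfun_pow (R_op Q) m) o\<^sub>L blinfun_pow (C_op Q) p)) h
        = blinfun_apply (RC_term Q p m) h"
      by (simp add: RC_term_def blinfun.scaleR_left blinfun_scale_apply blinfun_pow_R_op
          del: fact_Suc binomial_Suc_Suc)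
  qed
  ultimately show "RC_term Q p sums ((1 / fact (Suc p)) *\<^sub>R
      (pser_op sA (deriv_coeffs (Suc p) \<alpha>) (R_op Q) o\<^sub>L blinfun_pow (C_op Q) p))"
    by (simp only:)
qed

text \<open>Since \<open>R\<close> is a homomorphism from the algebra to its operators, \<open>f(R(Q))\<close> is left
  multiplication by \<open>f(Q)\<close>.  This identifies the terms of the two expansions.\<close>
lemma pser_op_apply:
  assumes Q: "norm Q < \<rho>"
  shows "blinfun_apply (pser_op sA (deriv_coeffs (Suc p) \<alpha>) (R_op Q)) h
    = pser_alg sA (deriv_coeffs (Suc p) \<alpha>) Q * h"
proof -
  let ?\<beta> = "deriv_coeffs (Suc p) \<alpha>"
  have sums: "(\<lambda>m. sA (?\<beta> m) (Q ^ m * h)) sums blinfun_apply (pser_op sA ?\<beta> (R_op Q)) h" for h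
    using bounded_linear.sums[OF blinfun.bounded_linear_left summable_sums[OF summable_pser_op[OF Q]], of p h]
    by (simp add: pser_op_def blinfun_scale_apply blinfun_pow_R_op)
  have "(\<lambda>m. sA (?\<beta> m) (Q ^ m)) sums pser_alg sA ?\<beta> Q"
    unfolding pser_alg_def using sums[of 1] by (simp add: sums_iff)
  from sums_mult2[OF this, of h]
  have "(\<lambda>m. sA (?\<beta> m) (Q ^ m * h)) sums (pser_alg sA ?\<beta> Q * h)"
    by (simp add: scale_mult_left)
  with sums show ?thesis
    using sums_unique2 by blast
qed

end

section \<open>The derivative of a composition\<close>

theorem mainTheorem3:
  fixes sA :: "'k::{real_normed_field,banach} \<Rightarrow> 'a::{real_normed_algebra_1,banach} \<Rightarrow> 'a"
    and sX :: "'k \<Rightarrow> 'x::banach \<Rightarrow> 'x"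
    and \<alpha> :: "nat \<Rightarrow> 'k"
    and R :: ereal and r :: real
    and D :: "'x set" and T :: "'x \<Rightarrow> 'a"
  assumes "unital_normed_algebra_over sA"
    and "normed_space_over sX"
    and "conv_radius \<alpha> = R" and "R > 0"
    and "0 < r" and "ereal r < R"
    and "open D"
    and "frechet_differentiable_on sX sA T D"
    and "T ` D \<subseteq> ball 0 r \<or>
      convex D \<and> bounded D \<and> (SUP x\<in>D. ereal (norm (frechet_deriv sX sA T x))) < \<infinity>"
    and "0 < (SUP x\<in>D. ereal (norm (T x)))"
    and "(SUP x\<in>D. ereal (norm (T x))) < R / 3"
  shows "frechet_differentiable_on sX sA (pser_alg sA \<alpha> \<circ> T) D
    \<and> (\<forall>x\<in>D. (\<lambda>p. series1_term sX sA \<alpha> T (Suc p) x)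
          sums frechet_deriv sX sA (pser_alg sA \<alpha> \<circ> T) x)
    \<and> (\<forall>x\<in>D. \<forall>h. (\<lambda>p. (1 / fact (Suc p)) *\<^sub>R series2_term sX sA \<alpha> T (Suc p) x h)
          sums blinfun_apply (frechet_deriv sX sA (pser_alg sA \<alpha> \<circ> T) x) h)
    \<and> ((SUP x\<in>D. ereal (norm (frechet_deriv sX sA T x))) < \<infinity> \<longrightarrow>
          abs_uniformly_convergent_on D (\<lambda>p x. series1_term sX sA \<alpha> T (Suc p) x)
        \<and> (\<forall>L>0. abs_uniformly_convergent_on (D \<times> ball 0 L)
              (\<lambda>p (x, h). (1 / fact (Suc p)) *\<^sub>R series2_term sX sA \<alpha> T (Suc p) x h)
            \<and> (\<Sum>p. ennreal (1 / fact (Suc p)) *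
                (SUP (x, h)\<in>D \<times> ball 0 L. ennreal (norm (series2_term sX sA \<alpha> T (Suc p) x h)))) < \<infinity>))"
proof -
  obtain \<rho> where rho: "(SUP x\<in>D. ereal (norm (T x))) < ereal \<rho>" "ereal \<rho> < R / 3"
    using ereal_dense2[OF assms(11)] by blast
  have rho_pos: "0 < \<rho>"
    using less_trans[OF assms(10) rho(1)] by simp
  have "ereal (norm (of_real (3 * \<rho>) :: 'k)) < conv_radius \<alpha>"
    using rho(2) rho_pos assms(3) by (cases R) (auto simp: field_simps)
  from abs_summable_in_conv_radius[OF this]
  have "summable (\<lambda>n. norm (\<alpha> n) * (3 * \<rho>) ^ n)"
    using rho_pos by (simp add: norm_mult norm_power)
  then interpret banach_algebra_power_series sA \<alpha> \<rho>
    using assms(1) rho_pos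
    by (simp add: banach_algebra_power_series_def banach_algebra_power_series_axioms_def)
  have T_less: "norm (T x) < \<rho>" if "x \<in> D" for x
    using le_less_trans[OF SUP_upper[OF that] rho(1)] by simp

  let ?T' = "frechet_deriv sX sA T"
  have T': "has_frechet_deriv sX sA T (?T' x) x" if "x \<in> D" for x
    using assms(8) that frechet_deriv_eq unfolding frechet_differentiable_on_def by metis
  have deriv: "has_frechet_deriv sX sA (pser_alg sA \<alpha> \<circ> T) (pser_deriv (T x) o\<^sub>L ?T' x) x"
    if "x \<in> D" for x
  proof -
    have "((pser_alg sA \<alpha> \<circ> T) has_derivative blinfun_apply (pser_deriv (T x)) \<circ> blinfun_apply (?T' x)) (at x)"
      using T'[OF that] pser_alg_has_derivative[OF T_less[OF that]]
      unfolding has_frechet_deriv_def by (blast intro: diff_chain_at)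
    moreover have "Vector_Spaces.linear sX sA (blinfun_apply (pser_deriv (T x)) \<circ> blinfun_apply (?T' x))"
      using T'[OF that] K_linear_pser_deriv[OF T_less[OF that]]
      unfolding has_frechet_deriv_def K_linear_def by (blast intro: Vector_Spaces.linear_compose)
    moreover have "blinfun_apply (pser_deriv (T x) o\<^sub>L ?T' x)
        = blinfun_apply (pser_deriv (T x)) \<circ> blinfun_apply (?T' x)"
      by (simp add: fun_eq_iff)
    ultimately show ?thesis
      unfolding has_frechet_deriv_def K_linear_def by simp
  qed
  then have diff: "frechet_differentiable_on sX sA (pser_alg sA \<alpha> \<circ> T) D"
    unfolding frechet_differentiable_on_def by blast

  have series1: "series1_term sX sA \<alpha> T (Suc p) x = (\<Sum>m. RC_term (T x) p m) o\<^sub>L ?T' x"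
    if "x \<in> D" for p x
    unfolding pser_op_compose_eq_row[OF T_less[OF that], symmetric] series1_term_def
    by (rule blinfun_eqI) (simp add: blinfun.scaleR_left)
  have series2: "(1 / fact (Suc p)) *\<^sub>R series2_term sX sA \<alpha> T (Suc p) x h
      = blinfun_apply (series1_term sX sA \<alpha> T (Suc p) x) h" if "x \<in> D" for p x h
    by (simp add: series1_term_def series2_term_def blinfun.scaleR_left pser_op_apply[OF T_less[OF that]])

  have sums1: "(\<lambda>p. series1_term sX sA \<alpha> T (Suc p) x) sums frechet_deriv sX sA (pser_alg sA \<alpha> \<circ> T) x"
    if "x \<in> D" for x
    unfolding series1[OF that] frechet_deriv_eq[OF deriv[OF that]]
    by (rule bounded_linear.sums[OF bounded_bilinear.bounded_linear_left[OF bounded_bilinear_blinfun_compose]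
          rows_sums_pser_deriv[OF T_less[OF that]]])
  have sums2: "(\<lambda>p. (1 / fact (Suc p)) *\<^sub>R series2_term sX sA \<alpha> T (Suc p) x h)
      sums blinfun_apply (frechet_deriv sX sA (pser_alg sA \<alpha> \<circ> T) x) h" if "x \<in> D" for x h
    unfolding series2[OF that]
    by (rule bounded_linear.sums[OF blinfun.bounded_linear_left sums1[OF that]])

  have uniform: "abs_uniformly_convergent_on D (\<lambda>p x. series1_term sX sA \<alpha> T (Suc p) x)
        \<and> (\<forall>L>0. abs_uniformly_convergent_on (D \<times> ball 0 L)
              (\<lambda>p (x, h). (1 / fact (Suc p)) *\<^sub>R series2_term sX sA \<alpha> T (Suc p) x h)
            \<and> (\<Sum>p. ennreal (1 / fact (Suc p)) *
                (SUP (x, h)\<in>D \<times> ball 0 L. ennreal (norm (series2_term sX sA \<alpha> T (Suc p) x h)))) < \<infinity>)"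
    if finite: "(SUP x\<in>D. ereal (norm (?T' x))) < \<infinity>"
  proof -
    obtain M where "(SUP x\<in>D. ereal (norm (?T' x))) < ereal (real M)"
      using finite less_PInf_Ex_of_nat by auto
    then have M: "norm (?T' x) \<le> real M" if "x \<in> D" for x
      using le_less_trans[OF SUP_upper[OF that]] by force
    \<comment> \<open>The majorant for the Weierstrass test, the same for all \<open>x\<close> in \<open>D\<close>.\<close>
    define N where "N p = (\<Sum>m. weight p m) * real M" for p
    have N_summable: "summable N"
      unfolding N_def by (rule summable_mult2[OF summable_weight_rows])
    have N_nonneg: "0 \<le> N p" for p
      unfolding N_def by (intro mult_nonneg_nonneg suminf_nonneg summable_weight_row weight_nonneg) simp
    have bound1: "norm (series1_term sX sA \<alpha> T (Suc p) x) \<le> N p" if "x \<in> D" for p x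
      unfolding series1[OF that] N_def
      using norm_row_le[OF T_less[OF that], of p] M[OF that]
      by (intro order_trans[OF norm_blinfun_compose] mult_mono)
         (auto intro: suminf_nonneg summable_weight_row weight_nonneg)
    have bound2: "norm ((1 / fact (Suc p)) *\<^sub>R series2_term sX sA \<alpha> T (Suc p) x h) \<le> N p * L"
      if "x \<in> D" "h \<in> ball 0 L" for p x h L
      unfolding series2[OF that(1)]
      using bound1[OF that(1), of p] that(2) N_nonneg
      by (intro order_trans[OF norm_blinfun] mult_mono) auto
    have conv1: "abs_uniformly_convergent_on D (\<lambda>p x. series1_term sX sA \<alpha> T (Suc p) x)"
      unfolding abs_uniformly_convergent_on_def
      by (rule ennreal_suminf_le_finite[OF _ N_summable N_nonneg])
         (auto intro!: SUP_least ennreal_leI bound1)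
    have conv2: "abs_uniformly_convergent_on (D \<times> ball 0 L)
        (\<lambda>p (x, h). (1 / fact (Suc p)) *\<^sub>R series2_term sX sA \<alpha> T (Suc p) x h)" if "L > 0" for L
      unfolding abs_uniformly_convergent_on_def
    proof (rule ennreal_suminf_le_finite[OF _ summable_mult2[OF N_summable, of L]])
      show "0 \<le> N p * L" for p
        using N_nonneg that by simp
      show "(SUP u\<in>D \<times> ball 0 L. ennreal (norm (case u of (x, h) \<Rightarrow>
          (1 / fact (Suc p)) *\<^sub>R series2_term sX sA \<alpha> T (Suc p) x h))) \<le> ennreal (N p * L)" for p
        using bound2 by (intro SUP_least ennreal_leI) (clarsimp simp del: norm_scaleR fact_Suc)
    qed
    \<comment> \<open>The two forms of uniform convergence of the second series differ only in whether \<open>1 / p!\<close> stands inside the supremum.\<close>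
    have pull: "ennreal (1 / fact (Suc p)) *
          (SUP (x, h)\<in>D \<times> ball 0 L. ennreal (norm (series2_term sX sA \<alpha> T (Suc p) x h)))
        = (SUP u\<in>D \<times> ball 0 L. ennreal (norm (case u of (x, h) \<Rightarrow>
            (1 / fact (Suc p)) *\<^sub>R series2_term sX sA \<alpha> T (Suc p) x h)))" for p L
      unfolding SUP_mult_left_ennreal
      by (intro SUP_cong) (auto simp: ennreal_mult[symmetric] simp del: fact_Suc)
    show ?thesis
      using conv1 conv2 unfolding pull abs_uniformly_convergent_on_def by blast
  qed
  show ?thesis
    using diff sums1 sums2 uniform by blast
qed

end
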